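(* Let $f:I\subseteq\mathbb{R}\to\mathbb{R}$ be a differentiable mapping on $I^{\circ}$ such that $f'\in L[a,b]$, where $a,b\in I^{\circ}$ with $a<b$. If $|f'|^{q}$ is a $P$-function on $[a,b]$, $q>1$, and $\frac1p+\frac1q=1$, then $$\left|f\left(\frac{a+b}{2}\right)-\frac{1}{b-a}\int_{a}^{b}f(x)\,dx\right|\leq\frac{b-a}{4}\left(\frac{1}{p+1}\right)^{\frac1p}\left\{\left(\left|f'\left(\tfrac{a+b}{2}\right)\right|^{q}+|f'(a)|^{q}\right)^{\frac1q}+\left(\left|f'\left(\tfrac{a+b}{2}\right)\right|^{q}+|f'(b)|^{q}\right)^{\frac1q}\right\},$$ and moreover $$\left|f\left(\frac{a+b}{2}\right)-\frac{1}{b-a}\int_{a}^{b}f(x)\,dx\right|\leq\frac{b-a}{4}\left(\frac{1}{p+1}\right)^{\frac1p}\left\{\left(|f'(b)|^{q}+2|f'(a)|^{q}\right)^{\frac1q}+\left(|f'(a)|^{q}+2|f'(b)|^{q}\right)^{\frac1q}\right\}.$$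
   Context: $I$ is an interval of real numbers and $I^{\circ}$ is its interior. $L[a,b]$ denotes the integrable functions on $[a,b]$. A function $g:J\to\mathbb{R}$ on an interval $J$ is a $P$-function if $g$ is non-negative and $g(tx+(1-t)y)\leq g(x)+g(y)$ for all $x,y\in J$ and $t\in[0,1]$. *)

theory Defs
  imports "HOL-Analysis.Analysis"
begin

definition P_function_on :: "real set \<Rightarrow> (real \<Rightarrow> real) \<Rightarrow> bool" where
  "P_function_on J g \<longleftrightarrow>
     is_interval J \<and> (\<forall>x\<in>J. 0 \<le> g x) \<and>
     (\<forall>x\<in>J. \<forall>y\<in>J. \<forall>t\<in>{0..1}. g (t * x + (1 - t) * y) \<le> g x + g y)"

end

theory Submission
  imports Defs
begin

text \<open>
  A \<open>P\<close>-function is bounded on every segment by the sum of its values at the two end points.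
  Applied to \<open>\<bar>f'\<bar>\<^sup>q\<close> on the two halves of \<open>[a, b]\<close>, with midpoint \<open>m\<close>, this turns the
  hypothesis into pointwise bounds \<open>\<bar>f'\<bar> \<le> K\<close> on \<open>[a, m]\<close> and \<open>\<bar>f'\<bar> \<le> L\<close> on \<open>[m, b]\<close>, where
  \<open>K\<close> and \<open>L\<close> are exactly the two \<open>q\<close>-th roots of the first claimed estimate. By the mean
  value theorem \<open>f\<close> then differs from \<open>f m\<close> by at most \<open>K\<close> or \<open>L\<close> times the distance to \<open>m\<close>,
  and integrating this distance over both halves bounds the midpoint error by
  \<open>(b - a) / 8 * (K + L)\<close> (lemma \<open>midpoint_error_le\<close>). The exponent \<open>p\<close> enters
  only when this is weakened to the claimed factor, by
  \<open>1 / 2 \<le> (1 / (p + 1)) powr (1 / p)\<close>, equivalent to Bernoulli's inequality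
  \<open>1 + p \<le> (1 + 1) powr p\<close> (lemma \<open>half_le_inverse_Suc_powr_inverse\<close>).

  The second estimate follows from the first by monotonicity, since
  \<open>\<bar>f' m\<bar>\<^sup>q \<le> \<bar>f' a\<bar>\<^sup>q + \<bar>f' b\<bar>\<^sup>q\<close>.
\<close>

lemma P_function_on_le_on_segment:
  assumes "P_function_on J g" "u \<in> J" "v \<in> J" "x \<in> {u..v}"
  shows "g x \<le> g u + g v"
proof -
  have "x \<in> closed_segment v u"
    using assms(4) by (simp add: closed_segment_eq_real_ivl)
  then obtain t where "t \<in> {0..1}" "x = t * u + (1 - t) * v"
    unfolding closed_segment_def by (auto simp: add.commute)
  then show ?thesis
    using assms unfolding P_function_on_def by blast
qed

lemma abs_le_powr_inverse_of_powr_le: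
  fixes y q S :: real
  assumes "\<bar>y\<bar> powr q \<le> S" "q > 0"
  shows "\<bar>y\<bar> \<le> S powr (1 / q)"
proof -
  have "\<bar>y\<bar> = (\<bar>y\<bar> powr q) powr (1 / q)"
    using assms(2) by (simp add: powr_powr)
  also have "\<dots> \<le> S powr (1 / q)"
    using assms by (intro powr_mono2) auto
  finally show ?thesis .
qed

text \<open>
  Taking \<open>p\<close>-th powers, this is Bernoulli's inequality \<open>p + 1 \<le> 2 powr p\<close>. It holds because
  \<open>2 powr p = 2 * exp ((p - 1) * ln 2)\<close>, where \<open>exp y \<ge> 1 + y\<close> and \<open>ln 2 \<ge> 1 / 2\<close>.
\<close>

lemma half_le_inverse_Suc_powr_inverse:
  fixes p :: real
  assumes "p \<ge> 1"
  shows "1 / 2 \<le> (1 / (p + 1)) powr (1 / p)"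
proof -
  have "1 / 2 \<le> ln (2::real)"
    using ln_le_minus_one[of "1 / 2"] by (simp add: ln_div)
  then have "(p - 1) * (1 / 2) \<le> (p - 1) * ln 2"
    using assms by (intro mult_left_mono) auto
  then have "p + 1 \<le> 2 * (1 + (p - 1) * ln 2)"
    by simp
  also have "\<dots> \<le> 2 * exp ((p - 1) * ln 2)"
    by (intro mult_left_mono exp_ge_add_one_self) auto
  also have "\<dots> = 2 powr p"
    by (simp add: powr_def left_diff_distrib exp_diff)
  finally have "p + 1 \<le> 2 powr p" .
  then have "(p + 1) powr (1 / p) \<le> (2 powr p) powr (1 / p)"
    using assms by (intro powr_mono2) auto
  also have "\<dots> = 2"
    using assms by (simp add: powr_powr)
  finally show ?thesis
    using assms by (simp add: powr_divide field_simps)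
qed

text \<open>
  By the mean value theorem \<open>\<bar>f x - f c\<bar> \<le> K * \<bar>x - c\<bar>\<close>, and the right-hand side integrates to
  \<open>K * (v - u)\<^sup>2 / 2\<close>. Either end point is admitted as \<open>c\<close> because the midpoint of an interval
  is the right end point of its left half and the left end point of its right half.
\<close>

lemma integral_deviation_from_endpoint_le:
  fixes f f' :: "real \<Rightarrow> real"
  assumes "u \<le> v" and c: "c = u \<or> c = v"
    and deriv: "\<And>x. x \<in> {u..v} \<Longrightarrow> (f has_real_derivative f' x) (at x within {u..v})"
    and bound: "\<And>x. x \<in> {u..v} \<Longrightarrow> \<bar>f' x\<bar> \<le> K"
  shows "\<bar>integral {u..v} f - (v - u) * f c\<bar> \<le> K * (v - u)\<^sup>2 / 2"
proof -
  have "continuous_on {u..v} f"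
    using deriv by (rule DERIV_continuous_on)
  then have f_int: "f integrable_on {u..v}"
    by (rule integrable_continuous_real)
  have dist: "((\<lambda>x. K * \<bar>x - c\<bar>) has_integral K * (v - u)\<^sup>2 / 2) {u..v}"
  proof -
    \<comment> \<open>the sign of \<open>x - c\<close> is constant on the interval, and is \<open>s\<close> away from \<open>c\<close>\<close>
    define s :: real where "s = (if c = u then 1 else - 1)"
    have "((\<lambda>x. K * (s * (x - c))) has_integral
        K * (s * (v - c)\<^sup>2 / 2) - K * (s * (u - c)\<^sup>2 / 2)) {u..v}"
      by (rule fundamental_theorem_of_calculus[OF \<open>u \<le> v\<close>])
        (auto simp flip: has_real_derivative_iff_has_vector_derivative
          intro!: derivative_eq_intros)
    moreover have "K * (s * (v - c)\<^sup>2 / 2) - K * (s * (u - c)\<^sup>2 / 2) = K * (v - u)\<^sup>2 / 2"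
      using c by (auto simp: s_def power2_commute)
    moreover have "K * (s * (x - c)) = K * \<bar>x - c\<bar>" if "x \<in> {u..v}" for x
      using c that by (auto simp: s_def)
    ultimately show ?thesis
      by (metis (no_types, lifting) has_integral_cong)
  qed
  have "\<bar>f x - f c\<bar> \<le> K * \<bar>x - c\<bar>" if "x \<in> {u..v}" for x
    using field_differentiable_bound[of "{u..v}" f f' K x c] deriv bound that c \<open>u \<le> v\<close>
    by auto
  then have "norm (integral {u..v} (\<lambda>x. f x - f c)) \<le> integral {u..v} (\<lambda>x. K * \<bar>x - c\<bar>)"
    using f_int dist
    by (intro integral_norm_bound_integral Henstock_Kurzweil_Integration.integrable_diff) (auto simp: has_integral_integrable)
  moreover have "integral {u..v} (\<lambda>x. f x - f c) = integral {u..v} f - (v - u) * f c"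
    using f_int \<open>u \<le> v\<close>
    by (subst Henstock_Kurzweil_Integration.integral_diff) auto
  ultimately show ?thesis
    unfolding integral_unique[OF dist] by simp
qed

lemma midpoint_error_le:
  fixes f f' :: "real \<Rightarrow> real"
  assumes "a < b"
    and deriv: "\<And>x. x \<in> {a..b} \<Longrightarrow> (f has_real_derivative f' x) (at x within {a..b})"
    and left: "\<And>x. x \<in> {a..(a + b) / 2} \<Longrightarrow> \<bar>f' x\<bar> \<le> K"
    and right: "\<And>x. x \<in> {(a + b) / 2..b} \<Longrightarrow> \<bar>f' x\<bar> \<le> L"
  shows "\<bar>f ((a + b) / 2) - 1 / (b - a) * integral {a..b} f\<bar> \<le> (b - a) / 8 * (K + L)"
proof -
  define m where "m = (a + b) / 2"
  have m: "a \<le> m" "m \<le> b" "m - a = (b - a) / 2" "b - m = (b - a) / 2"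
    using \<open>a < b\<close> by (auto simp: m_def field_simps)
  have "continuous_on {a..b} f"
    using deriv by (rule DERIV_continuous_on)
  then have split: "integral {a..m} f + integral {m..b} f = integral {a..b} f"
    using m by (intro Henstock_Kurzweil_Integration.integral_combine integrable_continuous_real)
  have "\<bar>integral {a..m} f - (m - a) * f m\<bar> \<le> K * (m - a)\<^sup>2 / 2"
    using m left
    by (intro integral_deviation_from_endpoint_le[where f' = f'])
      (auto simp: m_def intro: DERIV_subset[OF deriv])
  moreover have "\<bar>integral {m..b} f - (b - m) * f m\<bar> \<le> L * (b - m)\<^sup>2 / 2"
    using m right
    by (intro integral_deviation_from_endpoint_le[where f' = f'])
      (auto simp: m_def intro: DERIV_subset[OF deriv])
  ultimately have "\<bar>(integral {a..m} f - (m - a) * f m) + (integral {m..b} f - (b - m) * f m)\<bar>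
      \<le> K * (m - a)\<^sup>2 / 2 + L * (b - m)\<^sup>2 / 2"
    by linarith
  moreover have "(integral {a..m} f - (m - a) * f m) + (integral {m..b} f - (b - m) * f m)
      = integral {a..b} f - (b - a) * f m"
    unfolding split[symmetric] by (simp add: algebra_simps)
  moreover have "K * (m - a)\<^sup>2 / 2 + L * (b - m)\<^sup>2 / 2 = (b - a)\<^sup>2 / 8 * (K + L)"
    unfolding m(3,4) by (simp add: field_simps power2_eq_square)
  ultimately have "\<bar>integral {a..b} f - (b - a) * f m\<bar> \<le> (b - a)\<^sup>2 / 8 * (K + L)"
    by simp
  moreover have "\<bar>f m - 1 / (b - a) * integral {a..b} f\<bar>
      = \<bar>integral {a..b} f - (b - a) * f m\<bar> / (b - a)"
    using \<open>a < b\<close> by (simp add: abs_if field_simps)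
  ultimately show ?thesis
    using \<open>a < b\<close> by (simp add: m_def[symmetric] field_simps power2_eq_square)
qed

theorem corollary6:
  fixes f :: "real \<Rightarrow> real" and I :: "real set" and a b p q :: real
  assumes "is_interval I"
    and "f differentiable_on interior I"
    and "a \<in> interior I" and "b \<in> interior I" and "a < b"
    and "deriv f absolutely_integrable_on {a..b}"
    and "P_function_on {a..b} (\<lambda>x. \<bar>deriv f x\<bar> powr q)"
    and "q > 1" and "1 / p + 1 / q = 1"
  shows "\<bar>f ((a + b) / 2) - 1 / (b - a) * integral {a..b} f\<bar>
      \<le> (b - a) / 4 * (1 / (p + 1)) powr (1 / p) *
        ((\<bar>deriv f ((a + b) / 2)\<bar> powr q + \<bar>deriv f a\<bar> powr q) powr (1 / q)
          + (\<bar>deriv f ((a + b) / 2)\<bar> powr q + \<bar>deriv f b\<bar> powr q) powr (1 / q))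
    \<and> \<bar>f ((a + b) / 2) - 1 / (b - a) * integral {a..b} f\<bar>
      \<le> (b - a) / 4 * (1 / (p + 1)) powr (1 / p) *
        ((\<bar>deriv f b\<bar> powr q + 2 * \<bar>deriv f a\<bar> powr q) powr (1 / q)
          + (\<bar>deriv f a\<bar> powr q + 2 * \<bar>deriv f b\<bar> powr q) powr (1 / q))"
proof -
  define m where "m = (a + b) / 2"
  define g where "g x = \<bar>deriv f x\<bar> powr q" for x
  define K where "K = (g m + g a) powr (1 / q)"
  define L where "L = (g m + g b) powr (1 / q)"
  define C where "C = (b - a) / 4 * (1 / (p + 1)) powr (1 / p)"
  have m: "a \<le> m" "m \<le> b"
    using \<open>a < b\<close> by (auto simp: m_def)
  \<comment> \<open>serves the two halves of the interval and, with \<open>x = m\<close>, the second estimate\<close>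
  have g_le: "g x \<le> g u + g v" if "u \<in> {a..b}" "v \<in> {a..b}" "x \<in> {u..v}" for u v x
    using P_function_on_le_on_segment[OF assms(7)] that unfolding g_def by blast
  have "is_interval (interior I)"
    using assms(1) convex_interior by (simp add: is_interval_convex_1)
  then have "{a..b} \<subseteq> interior I"
    using assms(3,4) unfolding is_interval_1 by (meson atLeastAtMost_iff subsetI)
  then have deriv: "(f has_real_derivative deriv f x) (at x within {a..b})" if "x \<in> {a..b}" for x
    using assms(2) that
    by (metis DERIV_deriv_iff_real_differentiable differentiable_on_def at_within_open
        open_interior subsetD has_field_derivative_at_within)
  have left: "\<bar>deriv f x\<bar> \<le> K" if "x \<in> {a..m}" for x
    using g_le[of a m x] that m \<open>q > 1\<close> unfolding K_def g_def
    by (intro abs_le_powr_inverse_of_powr_le) auto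
  have right: "\<bar>deriv f x\<bar> \<le> L" if "x \<in> {m..b}" for x
    using g_le[of m b x] that m \<open>q > 1\<close> unfolding L_def g_def
    by (intro abs_le_powr_inverse_of_powr_le) auto
  have "0 < 1 / q" "1 / q < 1"
    using \<open>q > 1\<close> by auto
  then have "0 < 1 / p" "1 / p < 1"
    using assms(9) by linarith+
  then have "p \<ge> 1"
    by simp
  have C: "(b - a) / 8 \<le> C"
    using mult_left_mono[OF half_le_inverse_Suc_powr_inverse[OF \<open>p \<ge> 1\<close>], of "(b - a) / 4"]
      \<open>a < b\<close>
    unfolding C_def by simp
  have "\<bar>f m - 1 / (b - a) * integral {a..b} f\<bar> \<le> (b - a) / 8 * (K + L)"
    using midpoint_error_le[OF \<open>a < b\<close> deriv] left right unfolding m_def by blast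
  also have "\<dots> \<le> C * (K + L)"
    using C by (intro mult_right_mono) (auto simp: K_def L_def)
  finally have first: "\<bar>f m - 1 / (b - a) * integral {a..b} f\<bar> \<le> C * (K + L)" .
  have "g m \<le> g a + g b"
    using g_le[of a b m] m \<open>a < b\<close> by simp
  then have "K \<le> (g b + 2 * g a) powr (1 / q)" "L \<le> (g a + 2 * g b) powr (1 / q)"
    unfolding K_def L_def using \<open>q > 1\<close> by (auto intro!: powr_mono2 simp: g_def)
  then have "C * (K + L) \<le> C * ((g b + 2 * g a) powr (1 / q) + (g a + 2 * g b) powr (1 / q))"
    using C \<open>a < b\<close> by (intro mult_left_mono) auto
  with first show ?thesis
    unfolding C_def K_def L_def g_def m_def by (meson order_trans)
qed

end
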